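(* Any segment of the 1-parameter subgroup $g(t)=2e^{t/2}e_0$, $t\in\mathbb{R}$ (that is, $g(t)=e^{t/2}I$), parametrized by arclength, is a timelike longest arc in the space $(\mathrm{GL}^+(2,\mathbb{C}),d)$.
   Context: $\mathrm{GL}^+(2,\mathbb{C})$ is the Lie group of complex $2\times2$ matrices with positive real determinant. Let $e_0=\frac12 I$, $e_1=\frac12\begin{pmatrix}0&1\\1&0\end{pmatrix}$, $e_2=\frac12\begin{pmatrix}0&\mathbf{i}\\-\mathbf{i}&0\end{pmatrix}$, $e_3=\frac12\begin{pmatrix}1&0\\0&-1\end{pmatrix}$, and let $H=\mathrm{span}_{\mathbb{R}}(e_0,e_1,e_2,e_3)$ be the space of Hermitian matrices, with pseudoscalar product $\langle\cdot,\cdot\rangle$ whose quadratic form is $\langle h,h\rangle=h_0^2-h_1^2-h_2^2-h_3^2=4\det h$ for $h=\sum_{i=0}^3h_ie_i$. $l_g:h\mapsto gh$ is the left shift. A horizontal curve is a Lipschitzian curve with $g'(t)=dl_{g(t)}(u(t))$, $u(t)\in H$ for almost all $t$. It is timelike (resp. nonspacelike) if $\langle u(t),u(t)\rangle>0$ (resp. $\ge0$) for almost all $t$, and future directed if $\langle u(t),e_0\rangle>0$ for almost all $t$. The length of a nonspacelike curve is $\int\sqrt{\langle u(t),u(t)\rangle}\,dt$. The sub-Lorentzian (anti)metric $d(x,y)$ is the supremum of lengths of future directed nonspacelike horizontal curves from $x$ to $y$ ($-\infty$ if there are none); a longest arc is a future directed nonspacelike horizontal curve realizing this supremum between its endpoints.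 *)

theory Defs
  imports "HOL-Analysis.Analysis"
begin

type_synonym cmat2 = "complex^2^2"

definition GLplus :: "cmat2 set" where
  "GLplus = {g. Im (det g) = 0 \<and> Re (det g) > 0}"

definition e0 :: cmat2 where
  "e0 = (1/2) *\<^sub>R mat 1"

definition e1 :: cmat2 where
  "e1 = (1/2) *\<^sub>R vector [vector [0, 1], vector [1, 0]]"

definition e2 :: cmat2 where
  "e2 = (1/2) *\<^sub>R vector [vector [0, \<i>], vector [- \<i>, 0]]"

definition e3 :: cmat2 where
  "e3 = (1/2) *\<^sub>R vector [vector [1, 0], vector [0, -1]]"

definition H :: "cmat2 set" where
  "H = span {e0, e1, e2, e3}"

text \<open>
  Coordinates of a matrix of \<open>H\<close> in the basis \<open>e0, e1, e2, e3\<close> (see \<open>coord_combination\<close>);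
  the values outside \<open>H\<close> carry no meaning.
\<close>

definition coord0 :: "cmat2 \<Rightarrow> real" where "coord0 h = Re (h$1$1 + h$2$2)"
definition coord1 :: "cmat2 \<Rightarrow> real" where "coord1 h = Re (h$1$2 + h$2$1)"
definition coord2 :: "cmat2 \<Rightarrow> real" where "coord2 h = Im (h$1$2 - h$2$1)"
definition coord3 :: "cmat2 \<Rightarrow> real" where "coord3 h = Re (h$1$1 - h$2$2)"

definition pseudo_inner :: "cmat2 \<Rightarrow> cmat2 \<Rightarrow> real" where
  "pseudo_inner h k =
     coord0 h * coord0 k - coord1 h * coord1 k - coord2 h * coord2 k - coord3 h * coord3 k"

lemmas H_basis_defs = e0_def e1_def e2_def e3_def
lemmas coord_defs = coord0_def coord1_def coord2_def coord3_def

lemma coord_combination: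
  fixes h0 h1 h2 h3 :: real
  defines "h \<equiv> h0 *\<^sub>R e0 + h1 *\<^sub>R e1 + h2 *\<^sub>R e2 + h3 *\<^sub>R e3"
  shows "coord0 h = h0" "coord1 h = h1" "coord2 h = h2" "coord3 h = h3"
  by (simp_all add: h_def H_basis_defs coord_defs mat_def)

lemma H_combination:
  "h \<in> H \<longleftrightarrow> (\<exists>h0 h1 h2 h3. h = h0 *\<^sub>R e0 + h1 *\<^sub>R e1 + h2 *\<^sub>R e2 + h3 *\<^sub>R e3)"
  by (simp add: H_def span_insert span_empty algebra_simps)

lemma pseudo_inner_self_eq_det:
  assumes "h \<in> H"
  shows "complex_of_real (pseudo_inner h h) = 4 * det h"
proof -
  obtain h0 h1 h2 h3 where h: "h = h0 *\<^sub>R e0 + h1 *\<^sub>R e1 + h2 *\<^sub>R e2 + h3 *\<^sub>R e3"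
    using assms H_combination by blast
  show ?thesis
    unfolding pseudo_inner_def h coord_combination
    by (simp add: det_2 H_basis_defs mat_def complex_eq_iff algebra_simps power2_eq_square)
qed

text \<open>
  A horizontal curve is kept together with its control \<open>u\<close>, which \<open>g\<close> determines almost
  everywhere on \<open>{a..b}\<close>. Since the left shift is linear in the matrix, its differential sends
  \<open>u t\<close> to \<open>g t ** u t\<close>. On a compact interval, being Lipschitz for the matrix norm is the same
  as being Lipschitz for any Riemannian distance on the group.
\<close>

definition horizontal_curve :: "real \<Rightarrow> real \<Rightarrow> (real \<Rightarrow> cmat2) \<Rightarrow> (real \<Rightarrow> cmat2) \<Rightarrow> bool" where
  "horizontal_curve a b g u \<longleftrightarrow>
     a < b \<and> g ` {a..b} \<subseteq> GLplus \<and> (\<exists>L. L-lipschitz_on {a..b} g) \<and>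
     (AE t\<in>{a..b} in lebesgue.
        u t \<in> H \<and> (g has_vector_derivative (g t ** u t)) (at t within {a..b}))"

definition timelike_curve :: "real \<Rightarrow> real \<Rightarrow> (real \<Rightarrow> cmat2) \<Rightarrow> (real \<Rightarrow> cmat2) \<Rightarrow> bool" where
  "timelike_curve a b g u \<longleftrightarrow>
     horizontal_curve a b g u \<and> (AE t\<in>{a..b} in lebesgue. pseudo_inner (u t) (u t) > 0)"

definition nonspacelike_curve :: "real \<Rightarrow> real \<Rightarrow> (real \<Rightarrow> cmat2) \<Rightarrow> (real \<Rightarrow> cmat2) \<Rightarrow> bool" where
  "nonspacelike_curve a b g u \<longleftrightarrow>
     horizontal_curve a b g u \<and> (AE t\<in>{a..b} in lebesgue. pseudo_inner (u t) (u t) \<ge> 0)"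

definition future_directed :: "real \<Rightarrow> real \<Rightarrow> (real \<Rightarrow> cmat2) \<Rightarrow> bool" where
  "future_directed a b u \<longleftrightarrow> (AE t\<in>{a..b} in lebesgue. pseudo_inner (u t) e0 > 0)"

text \<open>
  For a horizontal curve the control is bounded and Lebesgue measurable up to a null set
  (\<open>g\<close> is Lipschitz), so the integrand below is integrable.
\<close>

definition curve_length :: "real \<Rightarrow> real \<Rightarrow> (real \<Rightarrow> cmat2) \<Rightarrow> real" where
  "curve_length a b u = (LINT t:{a..b}|lebesgue. sqrt (pseudo_inner (u t) (u t)))"

text \<open>In \<open>ereal\<close> the supremum of the empty set is \<open>-\<infinity>\<close>.\<close>

definition antimetric :: "cmat2 \<Rightarrow> cmat2 \<Rightarrow> ereal" where
  "antimetric x y =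
     Sup {ereal (curve_length a b u) | a b g u.
            nonspacelike_curve a b g u \<and> future_directed a b u \<and> g a = x \<and> g b = y}"

definition longest_arc :: "real \<Rightarrow> real \<Rightarrow> (real \<Rightarrow> cmat2) \<Rightarrow> (real \<Rightarrow> cmat2) \<Rightarrow> bool" where
  "longest_arc a b g u \<longleftrightarrow>
     nonspacelike_curve a b g u \<and> future_directed a b u \<and>
     ereal (curve_length a b u) = antimetric (g a) (g b)"

definition arclength_parametrized :: "real \<Rightarrow> real \<Rightarrow> (real \<Rightarrow> cmat2) \<Rightarrow> bool" where
  "arclength_parametrized a b u \<longleftrightarrow> (\<forall>t\<in>{a..b}. curve_length a t u = t - a)"

definition one_parameter_subgroup :: "(real \<Rightarrow> cmat2) \<Rightarrow> bool" where
  "one_parameter_subgroup g \<longleftrightarrow>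
     continuous_on UNIV g \<and> range g \<subseteq> GLplus \<and> (\<forall>s t. g (s + t) = g s ** g t)"

end

theory Submission
  imports Defs
begin

text \<open>
  The determinant is a calibration. Along a horizontal curve \<open>g' = g u\<close>, so Jacobi's formula gives
  \<open>(ln (det g))' = trace u = coord0 u\<close>: the logarithm of the determinant grows exactly at the rate
  of the time component of the control. For a future directed control the length element obeys
  the reversed Cauchy-Schwarz bound \<open>sqrt \<langle>u, u\<rangle> \<le> coord0 u\<close>. Integrating, every competitor from \<open>x\<close>
  to \<open>y\<close> has length at most \<open>ln (det y) - ln (det x)\<close>, a number that depends on the endpoints only
  (\<open>curve_length_le_log_det\<close>). The subgroup \<open>exp (t / 2) I\<close> has constant control \<open>e0\<close>, unit speed and
  determinant \<open>exp t\<close>, so on \<open>{a..b}\<close> its length \<open>b - a\<close> meets this bound.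

  The analytic point is that the curves are only Lipschitz and the equation for \<open>g'\<close> holds only
  almost everywhere. Integrating the derivative of \<open>ln (det g)\<close> thus needs the fundamental theorem
  of calculus for Lipschitz functions, \<open>fundamental_theorem_of_calculus_Lipschitz\<close>, and the fact that
  \<open>ln \<circ> det \<circ> g\<close> is Lipschitz on a compact interval.
\<close>

section \<open>The fundamental theorem of calculus for Lipschitz functions\<close>

text \<open>
  The limit that defines the derivative, along the steps \<open>1 / Suc k\<close>. It serves twice below: for the
  integrand at almost every point, and for the indefinite integral at both endpoints.
\<close>

lemma forward_quotients_LIMSEQ:
  fixes f :: "real \<Rightarrow> real"
  assumes "(f has_real_derivative d) (at t within {a..b})" and "a \<le> t" and "t < b"
  shows "(\<lambda>k. real (Suc k) * (f (t + 1 / real (Suc k)) - f t)) \<longlonglongrightarrow> d"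
proof -
  have h: "(\<lambda>k. t + 1 / real (Suc k)) \<longlonglongrightarrow> t"
    using tendsto_add[OF tendsto_const[of t] LIMSEQ_inverse_real_of_nat]
    by (simp add: inverse_eq_divide)
  then have "\<forall>\<^sub>F k in sequentially. t + 1 / real (Suc k) < b"
    using \<open>t < b\<close> order_tendstoD(2) by blast
  then have "\<forall>\<^sub>F k in sequentially. t + 1 / real (Suc k) \<in> {a..b} \<and> t + 1 / real (Suc k) \<noteq> t"
  proof (rule eventually_mono)
    fix k assume "t + 1 / real (Suc k) < b"
    moreover have "t < t + 1 / real (Suc k)" by simp
    ultimately show "t + 1 / real (Suc k) \<in> {a..b} \<and> t + 1 / real (Suc k) \<noteq> t"
      unfolding atLeastAtMost_iff using \<open>a \<le> t\<close> by linarith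
  qed
  with h have "filterlim (\<lambda>k. t + 1 / real (Suc k)) (at t within {a..b}) sequentially"
    by (simp add: filterlim_at)
  from filterlim_compose[OF assms(1)[unfolded has_field_derivative_iff] this]
  show ?thesis
    by (simp add: mult.commute del: of_nat_Suc)
qed

text \<open>
  The forward difference quotients of \<open>f\<close> are bounded by the Lipschitz constant and converge almost
  everywhere to \<open>f'\<close>, so dominated convergence lets their integrals converge to that of \<open>f'\<close>. By
  translation these integrals telescope to difference quotients of the indefinite integral of
  \<open>f\<close> at \<open>b\<close> minus those at \<open>a\<close>, which converge to \<open>f b - f a\<close> because \<open>f\<close> is continuous.
\<close>

lemma fundamental_theorem_of_calculus_Lipschitz:
  fixes f :: "real \<Rightarrow> real"
  assumes "a \<le> b" and lip: "L-lipschitz_on {a..b} f" and N: "negligible N"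
    and deriv: "\<And>t. t \<in> {a..b} - N \<Longrightarrow> (f has_real_derivative f' t) (at t within {a..b})"
  shows "(f' has_integral f b - f a) {a..b}"
proof -
  \<comment> \<open>Extending \<open>f\<close> by its boundary values keeps the Lipschitz constant and gives the forward
    quotients near \<open>b\<close> a meaning.\<close>
  define F where "F t = f (max a (min b t))" for t
  define h where "h k = 1 / real (Suc k)" for k
  define q where "q k t = real (Suc k) * (F (t + h k) - F t)" for k t
  define G where "G x = integral {a..x} F" for x
  have h: "0 < h k" "h k \<le> 1" for k
    by (auto simp: h_def)
  have "L \<ge> 0"
    using lip by (rule lipschitz_on_nonneg)
  have F_lip: "\<bar>F s - F t\<bar> \<le> L * \<bar>s - t\<bar>" for s t
  proof -
    have "\<bar>F s - F t\<bar> \<le> L * \<bar>max a (min b s) - max a (min b t)\<bar>"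
      unfolding F_def using lipschitz_onD[OF lip] \<open>a \<le> b\<close> by (auto simp: dist_real_def)
    also have "\<dots> \<le> L * \<bar>s - t\<bar>"
      using \<open>L \<ge> 0\<close> by (intro mult_left_mono) auto
    finally show ?thesis .
  qed
  then have "L-lipschitz_on UNIV F"
    using \<open>L \<ge> 0\<close> by (auto simp: lipschitz_on_def dist_real_def)
  then have F_cont: "continuous_on S F" for S
    using continuous_on_subset lipschitz_on_continuous_on by blast
  then have F_int: "F integrable_on {c..d}" for c d
    by (simp add: integrable_continuous_real)
  have F_eq: "F t = f t" if "t \<in> {a..b}" for t
    using that by (simp add: F_def)
  have shift: "((\<lambda>t. F (t + h k)) has_integral integral {a + h k..b + h k} F) {a..b}" for k
    by (subst has_integral_shift_real_ivl_iff[of _ _ "a + h k" "b + h k" "h k", simplified, symmetric])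
      (rule integrable_integral[OF F_int])
  have q_int: "(q k has_integral real (Suc k) * (G (b + h k) - G b) - real (Suc k) * (G (a + h k) - G a)) {a..b}"
    for k
  proof -
    have "integral {a + h k..b + h k} F = G (b + h k) - G (a + h k)"
      using Henstock_Kurzweil_Integration.integral_combine[OF _ _ F_int, of a "a + h k" "b + h k"] h[of k] \<open>a \<le> b\<close>
      by (simp add: G_def)
    then have "((\<lambda>t. F (t + h k) - F t) has_integral G (b + h k) - G (a + h k) - G b) {a..b}"
      using has_integral_diff[OF shift integrable_integral[OF F_int], of k] by (simp add: G_def)
    then have "(q k has_integral real (Suc k) * (G (b + h k) - G (a + h k) - G b)) {a..b}"
      unfolding q_def by (rule has_integral_mult_right)
    moreover have "G a = 0"
      by (simp add: G_def)
    ultimately show ?thesis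
      by (simp add: algebra_simps)
  qed
  have G_deriv: "(\<lambda>k. real (Suc k) * (G (x + h k) - G x)) \<longlonglongrightarrow> f x" if "x \<in> {a..b}" for x
  proof -
    have "(G has_real_derivative F x) (at x within {a..b + 1})"
      unfolding G_def using that by (intro integral_has_real_derivative F_cont) auto
    from forward_quotients_LIMSEQ[OF this] show ?thesis
      using that by (simp add: F_eq h_def)
  qed
  have lim_int: "(\<lambda>k. integral {a..b} (q k)) \<longlonglongrightarrow> f b - f a"
    using tendsto_diff[OF G_deriv[of b] G_deriv[of a]] \<open>a \<le> b\<close> integral_unique[OF q_int]
    by (simp del: of_nat_Suc)

  \<comment> \<open>The point \<open>b\<close> joins the exceptional set because the given derivative there is one-sided from
    the left, whereas the quotients look to the right. Setting everything to zero on this set makes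
    the convergence hold at every point.\<close>
  define M where "M = insert b N"
  have M: "negligible M"
    using N by (simp add: M_def)
  define q0 where "q0 k t = (if t \<in> M then 0 else q k t)" for k t
  define f0 where "f0 t = (if t \<in> M then 0 else f' t)" for t
  have q0_int: "q0 k integrable_on {a..b}" for k
    by (rule integrable_spike[OF has_integral_integrable[OF q_int[of k]] M]) (simp add: q0_def)
  have q0_bound: "norm (q0 k t) \<le> L" for k t
  proof -
    have "\<bar>q k t\<bar> \<le> real (Suc k) * (L * h k)"
      unfolding q_def abs_mult using F_lip[of "t + h k" t] h[of k] by (auto simp del: of_nat_Suc)
    then show ?thesis
      using \<open>L \<ge> 0\<close> by (simp add: q0_def h_def del: of_nat_Suc)
  qed
  have q0_lim: "(\<lambda>k. q0 k t) \<longlonglongrightarrow> f0 t" if "t \<in> {a..b}" for t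
  proof (cases "t \<in> M")
    case False
    then have t: "t \<in> {a..b} - N" "t < b"
      using that by (auto simp: M_def)
    have "(F has_real_derivative f' t) (at t within {a..b})"
      using has_vector_derivative_transform[OF that F_eq] deriv[OF t(1)]
      by (simp add: has_real_derivative_iff_has_vector_derivative)
    from forward_quotients_LIMSEQ[OF this] show ?thesis
      using t False by (simp add: q0_def f0_def q_def h_def)
  qed (simp add: q0_def f0_def)
  have q0_eq: "integral {a..b} (q0 k) = integral {a..b} (q k)" for k
    by (rule integral_spike[OF M]) (simp add: q0_def)
  have "f0 integrable_on {a..b}" "(\<lambda>k. integral {a..b} (q0 k)) \<longlonglongrightarrow> integral {a..b} f0"
    using dominated_convergence[where h = "\<lambda>_. L", OF q0_int _ q0_bound q0_lim] by auto
  then have "(f0 has_integral f b - f a) {a..b}"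
    using LIMSEQ_unique[OF lim_int] by (simp add: q0_eq has_integral_iff)
  then show ?thesis
    by (rule has_integral_spike[OF M, rotated]) (simp add: f0_def)
qed

section \<open>The logarithm of the determinant is Lipschitz along a Lipschitz curve\<close>

lemma lipschitz_on_mult_bounded:
  fixes f g :: "'a::metric_space \<Rightarrow> 'b::real_normed_algebra"
  assumes f: "K-lipschitz_on X f" "\<And>x. x \<in> X \<Longrightarrow> norm (f x) \<le> A"
    and g: "L-lipschitz_on X g" "\<And>x. x \<in> X \<Longrightarrow> norm (g x) \<le> B"
    and "A \<ge> 0" "B \<ge> 0"
  shows "(A * L + K * B)-lipschitz_on X (\<lambda>x. f x * g x)"
proof (rule lipschitz_onI)
  fix x y assume xy: "x \<in> X" "y \<in> X"
  have "f x * g x - f y * g y = f x * (g x - g y) + (f x - f y) * g y"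
    by (simp add: algebra_simps)
  then have "dist (f x * g x) (f y * g y) \<le> norm (f x * (g x - g y)) + norm ((f x - f y) * g y)"
    by (metis dist_norm norm_triangle_ineq)
  also have "\<dots> \<le> norm (f x) * norm (g x - g y) + norm (f x - f y) * norm (g y)"
    by (intro add_mono norm_mult_ineq)
  also have "\<dots> \<le> A * (L * dist x y) + (K * dist x y) * B"
    using f g xy lipschitz_on_nonneg[OF f(1)] \<open>A \<ge> 0\<close>
    by (intro add_mono mult_mono) (auto simp: lipschitz_on_def dist_norm)
  finally show "dist (f x * g x) (f y * g y) \<le> (A * L + K * B) * dist x y"
    by (simp add: algebra_simps)
qed (use assms lipschitz_on_nonneg in \<open>auto intro!: add_nonneg_nonneg mult_nonneg_nonneg\<close>)

lemma lipschitz_on_ln_compose: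
  fixes f :: "'a::metric_space \<Rightarrow> real"
  assumes f: "L-lipschitz_on X f" and m: "m > 0" "\<And>x. x \<in> X \<Longrightarrow> f x \<ge> m"
  shows "(L / m)-lipschitz_on X (\<lambda>x. ln (f x))"
proof (rule lipschitz_onI)
  have one_side: "ln (f x) - ln (f y) \<le> L / m * dist x y" if "x \<in> X" "y \<in> X" for x y
  proof -
    have pos: "f x > 0" "f y > 0" "f y \<ge> m"
      using m that by (auto intro: less_le_trans)
    have "ln (f x) - ln (f y) \<le> (f x - f y) / f y"
      using pos by (intro ln_diff_le)
    also have "\<dots> \<le> (L * dist x y) / m"
      using lipschitz_onD[OF f that] pos m lipschitz_on_nonneg[OF f]
      by (intro frac_le) (auto simp: dist_real_def)
    finally show ?thesis by simp
  qed
  fix x y assume "x \<in> X" "y \<in> X"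
  with one_side[of x y] one_side[of y x] show "dist (ln (f x)) (ln (f y)) \<le> L / m * dist x y"
    by (simp add: dist_real_def dist_commute abs_le_iff)
qed (use m lipschitz_on_nonneg[OF f] in auto)

text \<open>
  The determinant is a polynomial in the entries, which are Lipschitz with \<open>g\<close> and bounded because
  the interval is compact.
\<close>

lemma lipschitz_on_det:
  fixes g :: "real \<Rightarrow> cmat2"
  assumes "L-lipschitz_on {a..b} g"
  shows "\<exists>K. K-lipschitz_on {a..b} (\<lambda>t. det (g t))"
proof -
  have entry: "L-lipschitz_on {a..b} (\<lambda>t. g t $ i $ j)" for i j
  proof (rule lipschitz_onI)
    fix s t assume "s \<in> {a..b}" "t \<in> {a..b}"
    from lipschitz_onD[OF assms this] show "dist (g s $ i $ j) (g t $ i $ j) \<le> L * dist s t"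
      by (rule order.trans[OF dist_vec_nth_le order.trans[OF dist_vec_nth_le]])
  qed (rule lipschitz_on_nonneg[OF assms])
  have "compact (g ` {a..b})"
    by (intro compact_continuous_image lipschitz_on_continuous_on[OF assms] compact_Icc)
  then obtain B where B: "B > 0" "\<And>t. t \<in> {a..b} \<Longrightarrow> norm (g t) \<le> B"
    by (auto dest!: compact_imp_bounded simp: bounded_pos)
  have bound: "norm (g t $ i $ j) \<le> B" if "t \<in> {a..b}" for t i j
    by (rule order.trans[OF Finite_Cartesian_Product.norm_nth_le order.trans[OF Finite_Cartesian_Product.norm_nth_le B(2)[OF that]]])
  have prod: "(B * L + L * B)-lipschitz_on {a..b} (\<lambda>t. g t $ i $ j * g t $ k $ l)" for i j k l
  proof (rule lipschitz_on_mult_bounded)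
    show "L-lipschitz_on {a..b} (\<lambda>t. g t $ i $ j)" "L-lipschitz_on {a..b} (\<lambda>t. g t $ k $ l)"
      by (fact entry)+
  qed (use B(1) bound in auto)
  have "((B * L + L * B) + (B * L + L * B))-lipschitz_on {a..b} (\<lambda>t. det (g t))"
    unfolding det_2 by (rule lipschitz_on_diff; fact prod)
  then show ?thesis ..
qed

section \<open>The determinant as a calibration\<close>

text \<open>Jacobi's formula.\<close>

lemma has_vector_derivative_det:
  fixes g :: "real \<Rightarrow> cmat2"
  assumes "(g has_vector_derivative g t ** v) (at t within S)"
  shows "((\<lambda>t. det (g t)) has_vector_derivative det (g t) * trace v) (at t within S)"
proof -
  have entry: "((\<lambda>t. g t $ i $ j) has_vector_derivative (g t ** v) $ i $ j) (at t within S)" for i j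
    using bounded_linear.has_vector_derivative[OF bounded_linear_vec_nth
        bounded_linear.has_vector_derivative[OF bounded_linear_vec_nth assms]] .
  have "g t $ 1 $ 1 * (g t ** v) $ 2 $ 2 + (g t ** v) $ 1 $ 1 * g t $ 2 $ 2
      - (g t $ 1 $ 2 * (g t ** v) $ 2 $ 1 + (g t ** v) $ 1 $ 2 * g t $ 2 $ 1) = det (g t) * trace v"
    by (simp add: det_2 matrix_matrix_mult_def trace_def sum_2 algebra_simps)
  note derivative_eq = this
  show ?thesis
    unfolding derivative_eq[symmetric] unfolding det_2
    by (intro has_vector_derivative_diff has_vector_derivative_mult entry)
qed

lemma coord0_eq_Re_trace: "coord0 h = Re (trace h)"
  by (simp add: coord0_def trace_def sum_2)

lemma pseudo_inner_e0: "pseudo_inner h e0 = coord0 h"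
  by (simp add: pseudo_inner_def coord_defs e0_def mat_def)

text \<open>
  The reversed Cauchy-Schwarz inequality of Lorentzian geometry against the unit vector \<open>e0\<close>:
  dropping the three spatial squares only enlarges \<open>\<langle>h, h\<rangle>\<close>.
\<close>

lemma sqrt_pseudo_inner_le:
  assumes "pseudo_inner h e0 > 0"
  shows "sqrt (pseudo_inner h h) \<le> coord0 h"
proof (rule real_le_lsqrt)
  show "pseudo_inner h h \<le> (coord0 h)\<^sup>2"
    using zero_le_square[of "coord1 h"] zero_le_square[of "coord2 h"] zero_le_square[of "coord3 h"]
    unfolding pseudo_inner_def power2_eq_square by linarith
qed (use assms in \<open>simp add: pseudo_inner_e0\<close>)

lemma AE_in_set_imp_negligible:
  assumes "AE t\<in>S in lebesgue. P t"
  shows "\<exists>N. negligible N \<and> (\<forall>t\<in>S - N. P t)"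
proof -
  obtain N where "{t \<in> space lebesgue. \<not> (t \<in> S \<longrightarrow> P t)} \<subseteq> N" "N \<in> null_sets lebesgue"
    using assms unfolding eventually_ae_filter by auto
  then show ?thesis
    by (auto simp: negligible_iff_null_sets)
qed

text \<open>
  The determinant is real and positive on the group, and bounded away from zero on a compact
  curve, so its logarithm is Lipschitz; by Jacobi's formula the derivative is
  \<open>Re (trace (u t)) = coord0 (u t)\<close>.
\<close>

lemma has_integral_coord0_control:
  assumes "horizontal_curve a b g u"
  shows "((\<lambda>t. coord0 (u t)) has_integral ln (Re (det (g b))) - ln (Re (det (g a)))) {a..b}"
proof -
  obtain L where "a < b" and G: "g ` {a..b} \<subseteq> GLplus" and lip: "L-lipschitz_on {a..b} g"
    and ae: "AE t\<in>{a..b} in lebesgue.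
        u t \<in> H \<and> (g has_vector_derivative (g t ** u t)) (at t within {a..b})"
    using assms unfolding horizontal_curve_def by blast
  define D where "D t = Re (det (g t))" for t
  have det_eq: "det (g t) = complex_of_real (D t)" and D_pos: "D t > 0" if "t \<in> {a..b}" for t
    using subsetD[OF G imageI[OF that]] by (simp_all add: D_def GLplus_def complex_eq_iff)
  obtain K where K: "K-lipschitz_on {a..b} (\<lambda>t. det (g t))"
    using lipschitz_on_det[OF lip] by blast
  have D_lip: "K-lipschitz_on {a..b} D"
    unfolding lipschitz_on_def
  proof (intro conjI ballI)
    fix s t assume "s \<in> {a..b}" "t \<in> {a..b}"
    then show "dist (D s) (D t) \<le> K * dist s t"
      using lipschitz_onD[OF K] by (simp add: det_eq dist_of_real)
  qed (rule lipschitz_on_nonneg[OF K])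
  then have "continuous_on {a..b} D"
    by (rule lipschitz_on_continuous_on)
  then obtain t0 where "t0 \<in> {a..b}" "\<And>t. t \<in> {a..b} \<Longrightarrow> D t0 \<le> D t"
    using continuous_attains_inf[of "{a..b}" D] \<open>a < b\<close> by auto
  with D_lip D_pos have ln_lip: "(K / D t0)-lipschitz_on {a..b} (\<lambda>t. ln (D t))"
    by (intro lipschitz_on_ln_compose) auto
  obtain N where N: "negligible N"
    "\<And>t. t \<in> {a..b} - N \<Longrightarrow> (g has_vector_derivative (g t ** u t)) (at t within {a..b})"
    using AE_in_set_imp_negligible[OF ae] by blast
  have "((\<lambda>t. ln (D t)) has_real_derivative coord0 (u t)) (at t within {a..b})"
    if t: "t \<in> {a..b} - N" for t
  proof -
    have "(D has_vector_derivative Re (det (g t) * trace (u t))) (at t within {a..b})"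
      unfolding D_def
      using bounded_linear.has_vector_derivative[OF bounded_linear_Re
          has_vector_derivative_det[OF N(2)[OF t]]] .
    then have "(D has_real_derivative D t * coord0 (u t)) (at t within {a..b})"
      using t by (simp add: det_eq coord0_eq_Re_trace has_real_derivative_iff_has_vector_derivative)
    from DERIV_ln_divide[THEN DERIV_chain2, OF D_pos this] show ?thesis
      using t D_pos[of t] by simp
  qed
  from fundamental_theorem_of_calculus_Lipschitz[OF less_imp_le[OF \<open>a < b\<close>] ln_lip N(1) this]
  show ?thesis
    by (simp add: D_def)
qed

text \<open>
  The integrated form of \<open>sqrt \<langle>u, u\<rangle> \<le> coord0 u\<close>. Rather than deriving measurability of the control,
  the proof treats a nonintegrable length element separately: the length then takes the default
  value 0, and the determinant does not decrease along a future directed curve.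
\<close>

lemma curve_length_le_log_det:
  assumes "horizontal_curve a b g u" and "future_directed a b u"
  shows "curve_length a b u \<le> ln (Re (det (g b))) - ln (Re (det (g a)))"
proof -
  note int = has_integral_coord0_control[OF assms(1)]
  define s where "s t = sqrt (pseudo_inner (u t) (u t))" for t
  obtain N where N: "negligible N"
    "\<And>t. t \<in> {a..b} - N \<Longrightarrow> pseudo_inner (u t) e0 > 0"
    using AE_in_set_imp_negligible[OF assms(2)[unfolded future_directed_def]] by blast
  define c where "c t = (if t \<in> N then 0 else coord0 (u t))" for t
  have c_int: "(c has_integral ln (Re (det (g b))) - ln (Re (det (g a)))) {a..b}"
    by (rule has_integral_spike[OF N(1) _ int]) (simp add: c_def)
  show ?thesis
  proof (cases "set_integrable lebesgue {a..b} s")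
    case True
    have "((\<lambda>t. if t \<in> N then 0 else s t) has_integral integral {a..b} s) {a..b}"
      by (rule has_integral_spike[OF N(1) _ integrable_integral])
        (use set_lebesgue_integral_eq_integral(1)[OF True] in auto)
    then have "integral {a..b} s \<le> ln (Re (det (g b))) - ln (Re (det (g a)))"
      by (rule has_integral_le[OF _ c_int]) (simp add: c_def s_def sqrt_pseudo_inner_le N(2))
    then show ?thesis
      using set_lebesgue_integral_eq_integral(2)[OF True] by (simp add: curve_length_def s_def)
  next
    case False
    then have "curve_length a b u = 0"
      unfolding curve_length_def s_def set_lebesgue_integral_def set_integrable_def
      by (rule not_integrable_integral_eq)
    moreover have "0 \<le> ln (Re (det (g b))) - ln (Re (det (g a)))"
      by (rule has_integral_nonneg[OF c_int]) (simp add: c_def less_imp_le N(2)[unfolded pseudo_inner_e0])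
    ultimately show ?thesis by simp
  qed
qed

lemma longest_arc_if_length_eq_log_det:
  assumes "nonspacelike_curve a b g u" and "future_directed a b u"
    and "curve_length a b u = ln (Re (det (g b))) - ln (Re (det (g a)))"
  shows "longest_arc a b g u"
proof -
  have "antimetric (g a) (g b) = ereal (curve_length a b u)"
    unfolding antimetric_def
  proof (rule Sup_eqI)
    fix l assume "l \<in> {ereal (curve_length a' b' u') | a' b' g' u'.
            nonspacelike_curve a' b' g' u' \<and> future_directed a' b' u' \<and> g' a' = g a \<and> g' b' = g b}"
    then obtain a' b' g' u' where l: "l = ereal (curve_length a' b' u')"
      and "nonspacelike_curve a' b' g' u'" "future_directed a' b' u'" "g' a' = g a" "g' b' = g b"
      by blast
    then have "curve_length a' b' u' \<le> ln (Re (det (g b))) - ln (Re (det (g a)))"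
      using curve_length_le_log_det[of a' b' g' u'] by (simp add: nonspacelike_curve_def)
    then show "l \<le> ereal (curve_length a b u)"
      by (simp add: l assms(3))
  qed (use assms in blast)
  with assms show ?thesis
    by (simp add: longest_arc_def)
qed

section \<open>The one-parameter subgroup\<close>

lemma scaleR_matrix_mult_mat_1:
  "(r *\<^sub>R mat 1 :: cmat2) ** (s *\<^sub>R mat 1) = (r * s) *\<^sub>R mat 1"
  by (simp add: vec_eq_iff matrix_matrix_mult_def mat_def sum_2 forall_2)

theorem proposition4:
  fixes g :: "real \<Rightarrow> cmat2" and a b :: real
  assumes "\<And>t. g t = (2 * exp (t / 2)) *\<^sub>R e0"
    and "a < b"
  shows "one_parameter_subgroup g \<and>
    (\<exists>u. timelike_curve a b g u \<and> arclength_parametrized a b u \<and> longest_arc a b g u)"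
proof -
  have g_eq: "g t = exp (t / 2) *\<^sub>R mat 1" for t
    by (simp add: assms(1) e0_def)
  have det_g: "det (g t) = complex_of_real (exp t)" for t
  proof -
    have "det (g t) = complex_of_real (exp (t / 2) * exp (t / 2))"
      by (simp add: g_eq det_2 mat_def complex_eq_iff)
    then show ?thesis
      by (simp flip: exp_add)
  qed
  have g_GLplus: "g t \<in> GLplus" for t
    by (simp add: GLplus_def det_g)
  have g_deriv: "(g has_vector_derivative g t ** e0) (at t within S)" for t S
  proof -
    have "((\<lambda>t. exp (t / 2)) has_real_derivative exp (t / 2) * (1 / 2)) (at t within S)"
      by (auto intro!: derivative_eq_intros)
    from has_vector_derivative_scaleR[OF this has_vector_derivative_const[of "mat 1 :: cmat2"]]
    show ?thesis
      by (simp add: g_eq[abs_def] e0_def scaleR_matrix_mult_mat_1 del: scaleR_scaleR)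
  qed
  have "one_parameter_subgroup g"
    unfolding one_parameter_subgroup_def
  proof (intro conjI allI)
    show "continuous_on UNIV g"
      unfolding g_eq[abs_def] by (intro continuous_intros) auto
    show "g (s + t) = g s ** g t" for s t
      by (simp add: g_eq scaleR_matrix_mult_mat_1 add_divide_distrib exp_add del: scaleR_scaleR)
  qed (use g_GLplus in auto)

  have g_lip: "\<exists>L. L-lipschitz_on {a..b} g"
  proof -
    have "continuous_on {a..b} (\<lambda>t. g t ** e0)"
      unfolding g_eq e0_def scaleR_matrix_mult_mat_1 by (intro continuous_intros) auto
    then have "bounded ((\<lambda>t. g t ** e0) ` {a..b})"
      by (intro compact_imp_bounded compact_continuous_image compact_Icc)
    then obtain B where "B > 0" "\<And>t. t \<in> {a..b} \<Longrightarrow> norm (g t ** e0) \<le> B"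
      by (auto simp: bounded_pos)
    then have "B-lipschitz_on {a..b} g"
      using g_deriv
      by (intro bounded_derivative_imp_lipschitz[where f' = "\<lambda>t h. h *\<^sub>R (g t ** e0)"])
        (auto simp: has_vector_derivative_def onorm_scaleR_left onorm_id intro!: onorm_bound)
    then show ?thesis ..
  qed
  have e0_unit: "pseudo_inner e0 e0 = 1"
    unfolding pseudo_inner_e0 by (simp add: coord0_def e0_def mat_def)
  have len: "curve_length a t (\<lambda>_. e0) = t - a" if "a \<le> t" for t
    using that by (simp add: curve_length_def e0_unit set_lebesgue_integral_def)
  have "timelike_curve a b g (\<lambda>_. e0)"
    using \<open>a < b\<close> g_GLplus g_lip g_deriv
    by (auto simp: timelike_curve_def horizontal_curve_def e0_unit H_def span_base)
  moreover have "arclength_parametrized a b (\<lambda>_. e0)"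
    by (simp add: arclength_parametrized_def len)
  moreover have "longest_arc a b g (\<lambda>_. e0)"
  proof (rule longest_arc_if_length_eq_log_det)
    show "nonspacelike_curve a b g (\<lambda>_. e0)"
      using calculation(1) by (auto simp: timelike_curve_def nonspacelike_curve_def e0_unit)
    show "future_directed a b (\<lambda>_. e0)"
      by (simp add: future_directed_def e0_unit)
    show "curve_length a b (\<lambda>_. e0) = ln (Re (det (g b))) - ln (Re (det (g a)))"
      using \<open>a < b\<close> by (simp add: len det_g del: of_real_exp)
  qed
  ultimately show ?thesis
    using \<open>one_parameter_subgroup g\<close> by blast
qed

end
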